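(* Let $\nu,\gamma,\delta,\mu>0$ and $h>0$ satisfy $\nu\ge\frac{\mu c_p^2h^2}{2}$ and $\mu\ge2(\gamma+\nu)$, with $\beta=2\nu-\mu c_p^2h^2>0$ and $\beta_3=\mu-2\nu-2\gamma\ge0$, and let $0<\alpha\le\frac12(\mu-2\gamma-2\nu)$. Let $k_0>0$ be such that for all $0<k\le k_0$ $$e^{\alpha k}<1+\frac{k\beta_3}{2}.$$ Then, for $0<k\le k_0$, the solution $\{Y^n\}_{n\ge1}$ of the backward Euler scheme with step size $k$ satisfies $$\|Y^M\|^2+k\beta_4e^{-\alpha(k+2t_M)}\sum_{n=1}^M\|\hat Y^n\|_1^2+2k\delta e^{-2\alpha t_M}\sum_{n=1}^Me^{-\alpha(2t_n+k)}\|\hat Y^n\|_{L^4}^4\le e^{-2\alpha t_M}\|Y^0\|^2,$$ where $\hat Y^n=e^{\alpha t_n}Y^n$ and $$\beta_4=\min\left\{\beta e^{-\alpha k},\ \beta_3e^{-\alpha k}-\frac{2(1-e^{-\alpha k})}{k}\right\}>0 .$$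
   Context: Notation: $(\cdot,\cdot)$ and $\|\cdot\|$ are the inner product and norm of $L^2(0,1)$; $\|v\|_1^2=\|v\|^2+\|v_x\|^2$; $H^1_{\{0\}}(0,1)=\{v\in H^1(0,1): v(0)=0\}$. Interpolation operator: $I_h:H^1(0,1)\to L^2(0,1)$ is linear and satisfies $\|\phi-I_h(\phi)\|\le c_ph\|\phi\|_1$ for all $\phi\in H^1(0,1)$, with $c_p$ independent of $\phi$ and $h$. Finite element space: $0=x_0<x_1<\dots<x_N=1$ is a partition of $(0,1)$ into $I_j=(x_{j-1},x_j)$ of length $h_j$, $h=\max_jh_j$, and $S_h\subset H^1_{\{0\}}(0,1)$ is the space of continuous functions $v_h$ on $[0,1]$ that are polynomials of degree $\le1$ on each $I_j$, with $v_h(0)=0$. Backward Euler scheme: $k=T/M$, $t_n=nk$ ($n=0,\dots,M$), $\bar\partial_t\phi^n=(\phi^n-\phi^{n-1})/k$. Find $Y^n\in S_h$, $n\ge1$, with $$(\bar\partial_tY^n,\chi)+\nu(Y^n_x,\chi_x)-\gamma(Y^n,\chi)+\delta((Y^n)^3,\chi)=-\mu(I_h(Y^n),\chi)\quad\forall\chi\in S_h,\qquad Y^0=y_{0h},$$ where $y_{0h}\in S_h$ is the given discrete initial datum. *)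

theory Defs
  imports "HOL-Analysis.Analysis" "HOL-Computational_Algebra.Polynomial"
begin

section \<open>Lebesgue and Sobolev spaces on the unit interval\<close>

text \<open>
  Elements of the spaces below are represented by functions on the reals, of which only the
  values on the open unit interval matter; equality in the spaces is equality almost everywhere
  with respect to the following measure.
\<close>

abbreviation unit_interval :: "real measure" where
  "unit_interval \<equiv> lebesgue_on {0<..<1}"

definition L2 :: "(real \<Rightarrow> real) set" where
  "L2 = {f \<in> borel_measurable unit_interval. integrable unit_interval (\<lambda>x. (f x)\<^sup>2)}"

definition L2_inner :: "(real \<Rightarrow> real) \<Rightarrow> (real \<Rightarrow> real) \<Rightarrow> real" where
  "L2_inner f g = (\<integral>x. f x * g x \<partial>unit_interval)"

definition L2_norm :: "(real \<Rightarrow> real) \<Rightarrow> real" where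
  "L2_norm f = sqrt (L2_inner f f)"

definition L4_norm :: "(real \<Rightarrow> real) \<Rightarrow> real" where
  "L4_norm f = root 4 (\<integral>x. \<bar>f x\<bar> ^ 4 \<partial>unit_interval)"

text \<open>
  The weak derivative is defined by testing against continuously differentiable functions with
  compact support in the open unit interval, as in Brezis' textbook.
\<close>

definition has_weak_deriv :: "(real \<Rightarrow> real) \<Rightarrow> (real \<Rightarrow> real) \<Rightarrow> bool" where
  "has_weak_deriv v g \<longleftrightarrow>
     (\<forall>\<phi> \<phi>'. (\<forall>x. (\<phi> has_real_derivative \<phi>' x) (at x)) \<and> continuous_on UNIV \<phi>' \<and>
         (\<exists>K. compact K \<and> K \<subseteq> {0<..<1} \<and> (\<forall>x. x \<notin> K \<longrightarrow> \<phi> x = 0)) \<longrightarrow>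
       L2_inner v \<phi>' = - L2_inner g \<phi>)"

definition H1 :: "(real \<Rightarrow> real) set" where
  "H1 = {v \<in> L2. \<exists>g \<in> L2. has_weak_deriv v g}"

text \<open>
  A weak derivative is unique only up to null sets, so the choice below is immaterial in
  integrals.
\<close>

definition weak_deriv :: "(real \<Rightarrow> real) \<Rightarrow> real \<Rightarrow> real" where
  "weak_deriv v = (SOME g. g \<in> L2 \<and> has_weak_deriv v g)"

definition H1_norm :: "(real \<Rightarrow> real) \<Rightarrow> real" where
  "H1_norm v = sqrt ((L2_norm v)\<^sup>2 + (L2_norm (weak_deriv v))\<^sup>2)"

section \<open>Interpolation operators\<close>

text \<open>
  The family is indexed by the mesh size of a partition of the unit interval, hence by numbers
  in the interval from 0 to 1.  Linearity is an identity in L2, hence holds almost everywhere;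
  that the operators respect equality almost everywhere follows from linearity together with
  the error bound.
\<close>

definition interpolation_operators ::
    "(real \<Rightarrow> (real \<Rightarrow> real) \<Rightarrow> (real \<Rightarrow> real)) \<Rightarrow> real \<Rightarrow> bool" where
  "interpolation_operators I c \<longleftrightarrow>
     (\<forall>h. 0 < h \<and> h \<le> 1 \<longrightarrow>
        (\<forall>\<phi>\<in>H1. I h \<phi> \<in> L2) \<and>
        (\<forall>\<phi>\<in>H1. \<forall>\<psi>\<in>H1. \<forall>a b.
           AE x in unit_interval. I h (\<lambda>x. a * \<phi> x + b * \<psi> x) x = a * I h \<phi> x + b * I h \<psi> x) \<and>
        (\<forall>\<phi>\<in>H1. L2_norm (\<lambda>x. \<phi> x - I h \<phi> x) \<le> c * h * H1_norm \<phi>))"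

section \<open>Finite element space and backward Euler scheme\<close>

definition unit_partition :: "(nat \<Rightarrow> real) \<Rightarrow> nat \<Rightarrow> bool" where
  "unit_partition x N \<longleftrightarrow> 1 \<le> N \<and> x 0 = 0 \<and> x N = 1 \<and> (\<forall>j\<in>{1..N}. x (j - 1) < x j)"

definition mesh_size :: "(nat \<Rightarrow> real) \<Rightarrow> nat \<Rightarrow> real" where
  "mesh_size x N = Max ((\<lambda>j. x j - x (j - 1)) ` {1..N})"

definition fe_space :: "(nat \<Rightarrow> real) \<Rightarrow> nat \<Rightarrow> (real \<Rightarrow> real) set" where
  "fe_space x N =
     {v. continuous_on {0..1} v \<and> v 0 = 0 \<and>
         (\<forall>j\<in>{1..N}. \<exists>p :: real poly. degree p \<le> 1 \<and> (\<forall>s\<in>{x (j - 1)<..<x j}. v s = poly p s))}"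

definition backward_euler_solution ::
    "(real \<Rightarrow> real) set \<Rightarrow> ((real \<Rightarrow> real) \<Rightarrow> (real \<Rightarrow> real)) \<Rightarrow> real \<Rightarrow> real \<Rightarrow> real \<Rightarrow> real \<Rightarrow>
     real \<Rightarrow> nat \<Rightarrow> (real \<Rightarrow> real) \<Rightarrow> (nat \<Rightarrow> real \<Rightarrow> real) \<Rightarrow> bool" where
  "backward_euler_solution S J \<nu> \<gamma> \<delta> \<mu> k M y0 Y \<longleftrightarrow>
     Y 0 = y0 \<and>
     (\<forall>n\<in>{1..M}. Y n \<in> S \<and>
        (\<forall>w\<in>S.
           L2_inner (\<lambda>x. (Y n x - Y (n - 1) x) / k) w
           + \<nu> * L2_inner (weak_deriv (Y n)) (weak_deriv w)
           - \<gamma> * L2_inner (Y n) w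
           + \<delta> * L2_inner (\<lambda>x. (Y n x) ^ 3) w
           = - \<mu> * L2_inner (J (Y n)) w))"

end

theory Submission
  imports Defs
begin

text \<open>
  Testing the scheme with \<open>w = Y n\<close> and absorbing the nudging term by Young's inequality together
  with the interpolation error bound yields a discrete energy inequality.  The cross term
  \<open>(Y (n - 1), Y n)\<close> is split by Young's inequality with the weight \<open>exp (\<alpha> k)\<close>, so that after
  multiplication by \<open>exp (2 \<alpha> t n - \<alpha> k)\<close> the inequality telescopes.  The analytic input is that
  continuous piecewise linear functions lie in \<open>H1\<close>, and that weak derivatives are unique almost
  everywhere; the latter is what makes \<open>H1_norm\<close> homogeneous, as \<open>weak_deriv\<close> is defined by choice.
\<close>

section \<open>Square-integrable functions on the unit interval\<close>

lemma finite_measure_unit_interval: "finite_measure unit_interval"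
  by (rule finite_measure_lebesgue_on) simp

lemma borel_measurable_unit_interval_continuous:
  assumes "continuous_on {0<..<1} f"
  shows "f \<in> borel_measurable unit_interval"
  using assms by (simp add: continuous_imp_measurable_on_sets_lebesgue)

lemma integrable_unit_interval_bounded:
  fixes f :: "real \<Rightarrow> real"
  assumes "f \<in> borel_measurable unit_interval" and "\<And>x. x \<in> {0<..<1} \<Longrightarrow> \<bar>f x\<bar> \<le> B"
  shows "integrable unit_interval f"
  by (rule finite_measure.integrable_const_bound[OF finite_measure_unit_interval, of _ B])
     (use assms in \<open>auto intro!: AE_I2\<close>)

lemma L2_bounded:
  assumes "f \<in> borel_measurable unit_interval" and "\<And>x. x \<in> {0<..<1} \<Longrightarrow> \<bar>f x\<bar> \<le> B"
  shows "f \<in> L2"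
proof -
  have "integrable unit_interval (\<lambda>x. (f x)\<^sup>2)"
  proof (rule integrable_unit_interval_bounded)
    show "\<bar>(f x)\<^sup>2\<bar> \<le> B\<^sup>2" if "x \<in> {0<..<1}" for x
      using power_mono[OF assms(2)[OF that], of 2] by simp
  qed (use assms(1) in simp)
  then show ?thesis
    using assms(1) by (simp add: L2_def)
qed

lemma continuous_bounded_unit_interval:
  fixes f :: "real \<Rightarrow> real"
  assumes "continuous_on {0..1} f"
  obtains B where "\<And>x. x \<in> {0..1} \<Longrightarrow> \<bar>f x\<bar> \<le> B"
proof -
  have "bounded (f ` {0..1})"
    using assms by (intro compact_imp_bounded compact_continuous_image) auto
  then show thesis
    using that by (fastforce simp: bounded_iff)
qed

lemma L2_continuous:
  assumes "continuous_on {0..1} f"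
  shows "f \<in> L2"
proof -
  obtain B where "\<And>x. x \<in> {0..1} \<Longrightarrow> \<bar>f x\<bar> \<le> B"
    using continuous_bounded_unit_interval[OF assms] by blast
  then show ?thesis
    using assms by (intro L2_bounded[of f B] borel_measurable_unit_interval_continuous)
      (auto intro: continuous_on_subset)
qed

lemma L2_measurable [measurable_dest]: "f \<in> L2 \<Longrightarrow> f \<in> borel_measurable unit_interval"
  by (simp add: L2_def)

lemma L2_mult_integrable:
  assumes "f \<in> L2" and "g \<in> L2"
  shows "integrable unit_interval (\<lambda>x. f x * g x)"
proof (rule Bochner_Integration.integrable_bound)
  show "integrable unit_interval (\<lambda>x. (f x)\<^sup>2 + (g x)\<^sup>2)"
    using assms by (simp add: L2_def)
  have "\<bar>a * b\<bar> \<le> a\<^sup>2 + b\<^sup>2" for a b :: real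
    using sum_squares_bound[of "\<bar>a\<bar>" "\<bar>b\<bar>"] by (auto simp: abs_mult intro: order_trans[rotated])
  then show "AE x in unit_interval. norm (f x * g x) \<le> norm ((f x)\<^sup>2 + (g x)\<^sup>2)"
    by (intro AE_I2) (simp add: abs_of_nonneg)
qed (use assms in \<open>auto intro: L2_measurable\<close>)

text \<open>The constant 1 is square integrable because the unit interval has finite measure, so
  \<open>f\<close> can be regarded as a product of two \<open>L2\<close> functions. This supplies
  the dominating function \<open>\<bar>f x\<bar>\<close> for the convergence arguments
  below.\<close>

lemma L2_integrable:
  assumes "f \<in> L2"
  shows "integrable unit_interval f"
  using L2_mult_integrable[OF assms L2_continuous[of "\<lambda>_. 1"]] by simp

lemma L2_lincomb:
  assumes f: "f \<in> L2" and g: "g \<in> L2"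
  shows "(\<lambda>x. a * f x + b * g x) \<in> L2"
proof -
  have "integrable unit_interval (\<lambda>x. a\<^sup>2 * (f x)\<^sup>2 + 2 * a * b * (f x * g x) + b\<^sup>2 * (g x)\<^sup>2)"
    using f g L2_mult_integrable[OF f g] by (simp add: L2_def)
  moreover have "(\<lambda>x. a\<^sup>2 * (f x)\<^sup>2 + 2 * a * b * (f x * g x) + b\<^sup>2 * (g x)\<^sup>2)
      = (\<lambda>x. (a * f x + b * g x)\<^sup>2)"
    by (rule ext) (simp add: power2_eq_square algebra_simps)
  ultimately show ?thesis
    using L2_measurable[OF f] L2_measurable[OF g] by (auto simp: L2_def)
qed

lemma L2_inner_lincomb:
  assumes "f \<in> L2" and "g \<in> L2" and "w \<in> L2"
  shows "L2_inner (\<lambda>x. a * f x + b * g x) w = a * L2_inner f w + b * L2_inner g w"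
proof -
  have "L2_inner (\<lambda>x. a * f x + b * g x) w
      = (\<integral>x. a * (f x * w x) + b * (g x * w x) \<partial>unit_interval)"
    by (simp add: L2_inner_def algebra_simps)
  then show ?thesis
    using assms by (simp add: L2_inner_def L2_mult_integrable)
qed

lemma L2_norm_power2: "(L2_norm f)\<^sup>2 = L2_inner f f"
  by (simp add: L2_norm_def L2_inner_def)

lemma H1_norm_power2: "(H1_norm v)\<^sup>2 = (L2_norm v)\<^sup>2 + (L2_norm (weak_deriv v))\<^sup>2"
  by (simp add: H1_norm_def)

lemma L2_norm_power2_scale: "(L2_norm (\<lambda>x. c * f x))\<^sup>2 = c\<^sup>2 * (L2_norm f)\<^sup>2"
proof -
  have "L2_inner (\<lambda>x. c * f x) (\<lambda>x. c * f x) = (\<integral>x. c\<^sup>2 * (f x * f x) \<partial>unit_interval)"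
    by (simp add: L2_inner_def power2_eq_square ac_simps)
  then show ?thesis
    by (simp add: L2_norm_power2 L2_inner_def)
qed

text \<open>The integral of a fourth power is nonnegative, with default value 0 if it diverges, so
  the fourth root is undone for every \<open>f\<close>; the absolute value disappears because the
  exponent is even.\<close>

lemma L4_norm_power4: "(L4_norm f) ^ 4 = (\<integral>x. (f x) ^ 4 \<partial>unit_interval)"
  by (simp add: L4_norm_def)

lemma L2_inner_cube: "L2_inner (\<lambda>x. (f x) ^ 3) f = (L4_norm f) ^ 4"
  by (simp add: L4_norm_power4 L2_inner_def flip: power_Suc2)

lemma L4_norm_power4_scale: "(L4_norm (\<lambda>x. c * f x)) ^ 4 = c ^ 4 * (L4_norm f) ^ 4"
  by (simp add: L4_norm_power4 power_mult_distrib)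

text \<open>Expanding the square \<open>(c * f x - g x)\<^sup>2 / (2 * c)\<close> gives the
  pointwise inequality. The weight is kept free because the energy estimate uses two values: one for
  the time difference and 1 for the interpolation error.\<close>

lemma L2_inner_Young:
  assumes f: "f \<in> L2" and g: "g \<in> L2" and "c > 0"
  shows "L2_inner f g \<le> (c * (L2_norm f)\<^sup>2 + (L2_norm g)\<^sup>2 / c) / 2"
proof -
  have "f x * g x \<le> c / 2 * (f x * f x) + 1 / (2 * c) * (g x * g x)" for x
  proof -
    have "0 \<le> (c * f x - g x)\<^sup>2 / (2 * c)"
      using \<open>c > 0\<close> by simp
    then show ?thesis
      using \<open>c > 0\<close> by (simp add: field_simps power2_eq_square)
  qed
  then have "L2_inner f g
      \<le> (\<integral>x. c / 2 * (f x * f x) + 1 / (2 * c) * (g x * g x) \<partial>unit_interval)"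
    unfolding L2_inner_def
    by (intro integral_mono L2_mult_integrable f g Bochner_Integration.integrable_add
        Bochner_Integration.integrable_mult_right)
  also have "\<dots> = (c * (L2_norm f)\<^sup>2 + (L2_norm g)\<^sup>2 / c) / 2"
    using f g \<open>c > 0\<close> by (simp add: L2_norm_power2 L2_inner_def L2_mult_integrable field_simps)
  finally show ?thesis .
qed

section \<open>Test functions for the weak derivative\<close>

definition test_function :: "(real \<Rightarrow> real) \<Rightarrow> (real \<Rightarrow> real) \<Rightarrow> bool" where
  "test_function \<phi> \<phi>' \<longleftrightarrow>
     (\<forall>x. (\<phi> has_real_derivative \<phi>' x) (at x)) \<and> continuous_on UNIV \<phi>' \<and>
     (\<exists>K. compact K \<and> K \<subseteq> {0<..<1} \<and> (\<forall>x. x \<notin> K \<longrightarrow> \<phi> x = 0))"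

lemma has_weak_deriv_iff:
  "has_weak_deriv v g \<longleftrightarrow> (\<forall>\<phi> \<phi>'. test_function \<phi> \<phi>' \<longrightarrow> L2_inner v \<phi>' = - L2_inner g \<phi>)"
  by (simp add: has_weak_deriv_def test_function_def)

lemma test_function_continuous:
  assumes "test_function \<phi> \<phi>'"
  shows "continuous_on A \<phi>" and "continuous_on A \<phi>'"
  using assms unfolding test_function_def
  by (meson DERIV_isCont continuous_at_imp_continuous_on, meson continuous_on_subset subset_UNIV)

lemma test_function_L2:
  assumes "test_function \<phi> \<phi>'"
  shows "\<phi> \<in> L2" and "\<phi>' \<in> L2"
  using test_function_continuous[OF assms] by (auto intro: L2_continuous)

text \<open>The bump is the product of the squared positive parts of \<open>x - a\<close> and
  \<open>b - x\<close>. Squaring makes a positive part continuously differentiable across its kink,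
  which is all the regularity that a test function must have.\<close>

lemma test_function_bump:
  assumes "0 < a" and "a < b" and "b < 1"
  obtains p p' where "test_function p p'" "\<And>x. 0 \<le> p x" "\<And>x. p x \<le> 1"
    "\<And>x. 0 < p x \<longleftrightarrow> x \<in> {a<..<b}"
proof -
  define p where "p x = (max 0 (x - a))\<^sup>2 * (max 0 (b - x))\<^sup>2" for x
  define p' where "p' x = 2 * max 0 (x - a) * (max 0 (b - x))\<^sup>2 - (max 0 (x - a))\<^sup>2 * (2 * max 0 (b - x))" for x
  have sq: "((\<lambda>x. (max 0 x)\<^sup>2) has_real_derivative 2 * max 0 x) (at x)" for x :: real
  proof -
    have "((\<lambda>x. (max 0 x)\<^sup>2) has_real_derivative 2 * x) (at x)" if "x > 0"
    proof (rule has_field_derivative_transform_within_open)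
      show "((\<lambda>x. x\<^sup>2) has_real_derivative 2 * x) (at x)"
        by (auto intro!: derivative_eq_intros)
    qed (use that in \<open>auto intro: open_greaterThan[of 0]\<close>)
    moreover have "((\<lambda>x. (max 0 x)\<^sup>2) has_real_derivative 0) (at x)" if "x < 0"
    proof (rule has_field_derivative_transform_within_open)
      show "((\<lambda>x. 0) has_real_derivative 0) (at x)"
        by simp
    qed (use that in \<open>auto intro: open_lessThan[of 0]\<close>)
    \<comment> \<open>At the kink the difference quotient is bounded by the absolute value of the
      increment, hence tends to 0.\<close>
    moreover have "((\<lambda>x. (max 0 x)\<^sup>2) has_real_derivative 0) (at (0 :: real))"
    proof -
      have "(\<lambda>h. (max 0 h)\<^sup>2 / h) \<midarrow>0\<rightarrow> (0 :: real)"
      proof (rule Lim_null_comparison)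
        show "\<forall>\<^sub>F h in at 0. norm ((max 0 h)\<^sup>2 / h) \<le> \<bar>h :: real\<bar>"
          by (rule always_eventually) (auto simp: max_def power2_eq_square)
        show "(\<lambda>h :: real. \<bar>h\<bar>) \<midarrow>0\<rightarrow> 0"
          by (intro tendsto_eq_intros) auto
      qed
      then show ?thesis
        by (simp add: DERIV_def)
    qed
    ultimately show ?thesis
      by (cases x "0 :: real" rule: linorder_cases) auto
  qed
  have "(p has_real_derivative p' x) (at x)" for x
  proof -
    have "((\<lambda>x. (max 0 (x - a))\<^sup>2) has_real_derivative 2 * max 0 (x - a)) (at x)"
      using DERIV_chain2[OF sq, of "\<lambda>x. x - a" 1 x UNIV]
      by (simp add: DERIV_ident DERIV_diff[where E = 0, simplified])
    moreover have "((\<lambda>x. (max 0 (b - x))\<^sup>2) has_real_derivative - (2 * max 0 (b - x))) (at x)"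
      using DERIV_chain2[OF sq, of "\<lambda>x. b - x" "-1" x UNIV]
      by (simp add: DERIV_ident DERIV_diff[where D = 0, simplified])
    ultimately show ?thesis
      unfolding p_def p'_def
      by (rule DERIV_mult[THEN DERIV_cong]) (simp add: algebra_simps)
  qed
  moreover have "continuous_on UNIV p'"
    unfolding p'_def by (intro continuous_intros)
  moreover have "p x = 0" if "x \<notin> {a..b}" for x
    using that by (auto simp: p_def)
  ultimately have "test_function p p'"
    using assms unfolding test_function_def by (auto intro!: exI[of _ "{a..b}"])
  moreover have "0 \<le> p x" for x
    by (simp add: p_def)
  moreover have "p x \<le> 1" for x
  proof (cases "x \<in> {a..b}")
    case True
    \<comment> \<open>Both bases are at most \<open>b - a\<close>, which is below 1.\<close>
    then have "(max 0 (x - a))\<^sup>2 \<le> 1" "(max 0 (b - x))\<^sup>2 \<le> 1"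
      using assms by (auto intro!: power_le_one)
    then show ?thesis
      unfolding p_def by (intro mult_le_one) auto
  qed (auto simp: p_def)
  moreover have "0 < p x \<longleftrightarrow> x \<in> {a<..<b}" for x
    by (auto simp: p_def zero_less_mult_iff)
  ultimately show thesis
    by (rule that)
qed

text \<open>
  If \<open>0 \<le> p \<le> 1\<close>, these test functions increase to the indicator function of \<open>{x. 0 < p x}\<close>.
\<close>

lemma test_function_one_minus_power:
  assumes "test_function p p'"
  shows "test_function (\<lambda>x. 1 - (1 - p x) ^ n) (\<lambda>x. real n * (1 - p x) ^ (n - 1) * p' x)"
proof -
  obtain K where "compact K" "K \<subseteq> {0<..<1}" "\<And>x. x \<notin> K \<Longrightarrow> p x = 0"
    using assms by (auto simp: test_function_def)
  moreover have "((\<lambda>x. 1 - (1 - p x) ^ n) has_real_derivative real n * (1 - p x) ^ (n - 1) * p' x) (at x)" for x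
    using assms unfolding test_function_def
    by (auto intro!: derivative_eq_intros)
  moreover have "continuous_on UNIV (\<lambda>x. real n * (1 - p x) ^ (n - 1) * p' x)"
    using test_function_continuous[OF assms] by (intro continuous_intros)
  ultimately show ?thesis
    unfolding test_function_def by (auto intro!: exI[of _ K])
qed

section \<open>The fundamental lemma of the calculus of variations\<close>

lemma sigma_finite_lebesgue: "sigma_finite_measure (lebesgue :: 'a :: euclidean_space measure)"
proof
  obtain A :: "'a set set" where A: "countable A \<and> A \<subseteq> sets lborel \<and> \<Union>A = space lborel \<and>
      (\<forall>a\<in>A. emeasure lborel a \<noteq> \<infinity>)"
    using lborel.sigma_finite_countable[where 'a = 'a] by (elim exE) (rule that)
  have "a \<in> sets lebesgue \<and> emeasure lebesgue a \<noteq> \<infinity>" if "a \<in> A" for a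
  proof -
    have a: "a \<in> sets lborel"
      using A that by blast
    then show ?thesis
      using A that by simp
  qed
  with A show "\<exists>A :: 'a set set. countable A \<and> A \<subseteq> sets lebesgue \<and> \<Union>A = space lebesgue \<and>
      (\<forall>a\<in>A. emeasure lebesgue a \<noteq> \<infinity>)"
    by (intro exI[of _ A] conjI ballI subsetI) (simp_all del: emeasure_completion)
qed

text \<open>The Borel sets over which \<open>f\<close> integrates to 0 form a Dynkin system, and it
  contains the open intervals, an intersection-stable generator. Lebesgue sets are Borel up to null
  sets, so every set integral of \<open>f\<close> vanishes and \<open>f\<close> is zero almost
  everywhere.\<close>

lemma AE_lebesgue_zero_if_intervals:
  fixes f :: "real \<Rightarrow> real"
  assumes f: "integrable lebesgue f"
    and interval: "\<And>a b. (\<integral>x\<in>{a<..<b}. f x \<partial>lebesgue) = 0"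
  shows "AE x in lebesgue. f x = 0"
proof (rule sigma_finite_measure.density_zero[OF sigma_finite_lebesgue f])
  have set_int: "set_integrable lebesgue A f" if "A \<in> sets lebesgue" for A
    unfolding set_integrable_def using integrable_mult_indicator[OF that f] .
  \<comment> \<open>The integral over the whole line is needed for complements in the Dynkin
    argument; it is the limit over the intervals from \<open>- n\<close> to
    \<open>n\<close>.\<close>
  have UNIV: "(\<integral>x. f x \<partial>lebesgue) = 0"
  proof -
    have "(\<lambda>n. \<integral>x\<in>{- real n<..<real n}. f x \<partial>lebesgue) \<longlonglongrightarrow> (\<integral>x. f x \<partial>lebesgue)"
      unfolding set_lebesgue_integral_def
    proof (rule integral_dominated_convergence[where w = "\<lambda>x. \<bar>f x\<bar>"])
      show "AE x in lebesgue. (\<lambda>n. indicator {- real n<..<real n} x *\<^sub>R f x) \<longlonglongrightarrow> f x"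
      proof (intro AE_I2 tendsto_eventually)
        fix x :: real
        have "\<forall>\<^sub>F n in sequentially. \<bar>x\<bar> < real n"
          using filterlim_real_sequentially by (simp add: filterlim_at_top_dense)
        then show "\<forall>\<^sub>F n in sequentially. indicator {- real n<..<real n} x *\<^sub>R f x = f x"
          by eventually_elim (auto simp: indicator_def)
      qed
      show "(\<lambda>x. indicator {- real n<..<real n} x *\<^sub>R f x) \<in> borel_measurable lebesgue" for n
        using set_int[of "{- real n<..<real n}"] by (simp add: set_integrable_def)
    qed (use f in \<open>auto simp: indicator_def\<close>)
    then show ?thesis
      by (simp add: interval LIMSEQ_const_iff)
  qed
  have borel: "(\<integral>x\<in>A. f x \<partial>lebesgue) = 0" if "A \<in> sets borel" for A
  proof -
    let ?G = "range (\<lambda>(a, b). box a b :: real set)"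
    have sets: "A \<in> sets lebesgue" if "A \<in> sigma_sets UNIV ?G" for A
      using that by (intro sets_completionI_sets) (simp add: borel_eq_box)
    have A: "A \<in> sigma_sets UNIV ?G"
      using that by (simp add: borel_eq_box)
    have stable: "Int_stable ?G"
      unfolding Int_stable_def
    proof (intro ballI)
      fix A B assume "A \<in> ?G" "B \<in> ?G"
      then obtain a b c d where "A = box a b" "B = box c d"
        by auto
      then have "A \<inter> B = box (max a c) (min b d)"
        by auto
      then show "A \<inter> B \<in> ?G"
        by (intro range_eqI[of _ _ "(max a c, min b d)"]) simp
    qed
    have "?G \<subseteq> Pow UNIV"
      by simp
    from stable this A show ?thesis
    proof (induction rule: sigma_sets_induct_disjoint)
      case (compl A)
      have "(\<integral>x\<in>UNIV - A. f x \<partial>lebesgue) = (\<integral>x. f x - indicator A x *\<^sub>R f x \<partial>lebesgue)"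
        unfolding set_lebesgue_integral_def
        by (intro Bochner_Integration.integral_cong) (auto simp: indicator_def)
      also have "\<dots> = 0"
        using compl(2) UNIV f set_int[OF sets[OF compl(1)]]
        by (simp add: set_integrable_def set_lebesgue_integral_def)
      finally show ?case .
    next
      case (union B)
      have "B i \<in> sets lebesgue" for i
        using union(2) by (intro sets) blast
      then have "(\<integral>x\<in>(\<Union>i. B i). f x \<partial>lebesgue) = (\<Sum>i. \<integral>x\<in>B i. f x \<partial>lebesgue)"
        using union(1) by (intro lebesgue_integral_countable_add set_int sets.countable_UN)
          (auto simp: disjoint_family_on_def)
      then show ?case
        by (simp add: union)
    qed (auto simp: interval set_lebesgue_integral_def[of _ "{}"])
  qed
  show "(\<integral>x\<in>A. f x \<partial>lebesgue) = 0" if "A \<in> sets lebesgue" for A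
  proof -
    \<comment> \<open>Outside the null set \<open>N'\<close> the indicators of \<open>A\<close> and
      of its Borel part \<open>S\<close> agree.\<close>
    from that obtain S N N' where A: "A = S \<union> N" "N \<subseteq> N'" "N' \<in> null_sets lborel" "S \<in> sets borel"
      by (auto elim: sets_completionE)
    then have "AE x in lebesgue. x \<notin> N'"
      by (intro AE_completion AE_not_in)
    then have "(\<integral>x\<in>A. f x \<partial>lebesgue) = (\<integral>x\<in>S. f x \<partial>lebesgue)"
      unfolding set_lebesgue_integral_def
    proof (intro integral_cong_AE)
      show "(\<lambda>x. indicator A x *\<^sub>R f x) \<in> borel_measurable lebesgue"
        using set_int[OF that] by (simp add: set_integrable_def)
      show "(\<lambda>x. indicator S x *\<^sub>R f x) \<in> borel_measurable lebesgue"
        using set_int[of S] A(4) by (simp add: set_integrable_def)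
    qed (use A(1,2) in \<open>auto elim!: eventually_mono simp: indicator_def\<close>)
    with borel[OF A(4)] show ?thesis
      by simp
  qed
qed

text \<open>Indicators of intervals compactly inside the unit interval are bounded pointwise limits
  of test functions, so orthogonality passes to them by dominated convergence. A second limit
  reaches all intervals, and extension of \<open>f\<close> by zero reduces the claim to the whole
  line.\<close>

lemma orthogonal_test_functions_imp_AE_zero:
  assumes f: "f \<in> L2" and orth: "\<And>\<phi> \<phi>'. test_function \<phi> \<phi>' \<Longrightarrow> L2_inner f \<phi> = 0"
  shows "AE x in unit_interval. f x = 0"
proof -
  note [measurable] = L2_measurable[OF f]
  have ind: "(\<lambda>x. indicat_real {a<..<b} x) \<in> borel_measurable unit_interval" for a b :: real
    by (intro measurable_restrict_space1 borel_measurable_indicator) simp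
  have compact_interval: "(\<integral>x. indicator {a<..<b} x * f x \<partial>unit_interval) = 0"
    if ab: "0 < a" "b < 1" for a b
  proof (cases "a < b")
    case True
    obtain p p' where p: "test_function p p'" "\<And>x. 0 \<le> p x" "\<And>x. p x \<le> 1"
      "\<And>x. 0 < p x \<longleftrightarrow> x \<in> {a<..<b}"
      using test_function_bump[OF ab(1) True ab(2)] by blast
    have [measurable]: "p \<in> borel_measurable unit_interval"
      using test_function_L2[OF p(1)] by (auto intro: L2_measurable)
    have "(\<lambda>n. \<integral>x. (1 - (1 - p x) ^ n) * f x \<partial>unit_interval)
        \<longlonglongrightarrow> (\<integral>x. indicator {a<..<b} x * f x \<partial>unit_interval)"
    proof (rule integral_dominated_convergence[where w = "\<lambda>x. \<bar>f x\<bar>"])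
      show "AE x in unit_interval. (\<lambda>n. (1 - (1 - p x) ^ n) * f x) \<longlonglongrightarrow> indicator {a<..<b} x * f x"
      proof (intro AE_I2 tendsto_intros)
        fix x
        show "(\<lambda>n. 1 - (1 - p x) ^ n) \<longlonglongrightarrow> indicator {a<..<b} x"
        \<comment> \<open>Inside the interval \<open>1 - p x\<close> lies in \<open>[0, 1)\<close>
          and its powers tend to 0; outside it \<open>p x\<close> is 0 and the sequence is
          constantly 0.\<close>
        proof (cases "x \<in> {a<..<b}")
          case True
          then have "0 < p x"
            using p(4) by blast
          then have "(\<lambda>n. (1 - p x) ^ n) \<longlonglongrightarrow> 0"
            using p(3)[of x] by (intro LIMSEQ_power_zero) simp
          then have "(\<lambda>n. 1 - (1 - p x) ^ n) \<longlonglongrightarrow> 1 - 0"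
            by (intro tendsto_diff tendsto_const)
          with True show ?thesis by simp
        next
          case False
          then have "p x = 0"
            using p(2)[of x] p(4)[of x] by auto
          with False show ?thesis by simp
        qed
      qed
      show "AE x in unit_interval. norm ((1 - (1 - p x) ^ n) * f x) \<le> \<bar>f x\<bar>" for n
      proof (intro AE_I2)
        fix x
        have "0 \<le> (1 - p x) ^ n" "(1 - p x) ^ n \<le> 1"
          using p(2)[of x] p(3)[of x] by (auto intro!: power_le_one)
        then show "norm ((1 - (1 - p x) ^ n) * f x) \<le> \<bar>f x\<bar>"
          by (auto simp: abs_mult intro!: mult_left_le_one_le)
      qed
    qed (use ind L2_integrable[OF f] in auto)
    moreover have "(\<integral>x. (1 - (1 - p x) ^ n) * f x \<partial>unit_interval) = 0" for n
      using orth[OF test_function_one_minus_power[OF p(1), of n]]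
      by (simp add: L2_inner_def mult.commute)
    ultimately show ?thesis
      by (simp add: LIMSEQ_const_iff)
  qed simp
  have interval: "(\<integral>x. indicator {a<..<b} x * f x \<partial>unit_interval) = 0" for a b
  proof -
    \<comment> \<open>The intersection with the unit interval is shrunk by \<open>1 / Suc n\<close>
      at both ends, which keeps the endpoints on the correct side of 0 and 1. The shrunken interval
      may be empty for small \<open>n\<close>; \<open>compact_interval\<close> allows this.\<close>
    define a' where "a' = (\<lambda>n. max a 0 + 1 / Suc n)"
    define b' where "b' = (\<lambda>n. min b 1 - 1 / Suc n)"
    have lim: "(\<lambda>n. 1 / real (Suc n)) \<longlonglongrightarrow> 0"
      using LIMSEQ_inverse_real_of_nat by (simp add: inverse_eq_divide)
    have b'_less: "b' n < min b 1" for n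
    proof -
      have "0 < 1 / real (Suc n)"
        by simp
      then show ?thesis
        unfolding b'_def by linarith
    qed
    have a': "a' \<longlonglongrightarrow> max a 0"
      using tendsto_add[OF tendsto_const lim, of "max a 0"] by (simp add: a'_def)
    have b': "b' \<longlonglongrightarrow> min b 1"
      using tendsto_diff[OF tendsto_const lim, of "min b 1"] by (simp add: b'_def)
    have "(\<lambda>n. \<integral>x. indicator {a' n<..<b' n} x * f x \<partial>unit_interval)
        \<longlonglongrightarrow> (\<integral>x. indicator {a<..<b} x * f x \<partial>unit_interval)"
    proof (rule integral_dominated_convergence[where w = "\<lambda>x. \<bar>f x\<bar>"])
      show "AE x in unit_interval. (\<lambda>n. indicator {a' n<..<b' n} x * f x)
          \<longlonglongrightarrow> indicator {a<..<b} x * f x"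
      proof (intro AE_I2 tendsto_intros tendsto_eventually)
        fix x assume x: "x \<in> space unit_interval"
        show "\<forall>\<^sub>F n in sequentially. indicator {a' n<..<b' n} x = indicat_real {a<..<b} x"
        proof (cases "x \<in> {a<..<b}")
          case True
          then have "\<forall>\<^sub>F n in sequentially. a' n < x" "\<forall>\<^sub>F n in sequentially. x < b' n"
            using x by (auto intro!: order_tendstoD[OF a'] order_tendstoD[OF b'])
          then show ?thesis
            by eventually_elim (use True in auto)
        next
          case False
          have "a \<le> a' n" for n
            by (auto simp: a'_def intro: add_increasing2)
          moreover have "b' n \<le> b" for n
            using b'_less[of n] by simp
          ultimately have "x \<notin> {a' n<..<b' n}" for n
            using False by (meson greaterThanLessThan_iff order_le_less_trans order_less_le_trans)
          with False show ?thesis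
            by simp
        qed
      qed
      show "AE x in unit_interval. norm (indicator {a' n<..<b' n} x * f x) \<le> \<bar>f x\<bar>" for n
        by (intro AE_I2) (auto simp: indicator_def)
    qed (use ind L2_integrable[OF f] in auto)
    moreover have "(\<integral>x. indicator {a' n<..<b' n} x * f x \<partial>unit_interval) = 0" for n
    proof (rule compact_interval)
      show "0 < a' n"
        unfolding a'_def by (rule add_nonneg_pos) auto
      show "b' n < 1"
        using b'_less[of n] by simp
    qed
    ultimately show ?thesis
      by (simp add: LIMSEQ_const_iff)
  qed
  let ?F = "\<lambda>x. indicator {0<..<1} x * f x"
  have "integrable lebesgue ?F"
    using L2_integrable[OF f] by (simp add: integrable_restrict_space)
  moreover have "(\<integral>x\<in>{a<..<b}. ?F x \<partial>lebesgue) = 0" for a b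
    using interval[of a b]
    by (simp add: integral_restrict_space set_lebesgue_integral_def ac_simps)
  ultimately have "AE x in lebesgue. ?F x = 0"
    by (rule AE_lebesgue_zero_if_intervals)
  then show ?thesis
    by (subst AE_restrict_space_iff) (auto elim!: eventually_mono)
qed

section \<open>Weak derivatives and the space H1\<close>

lemma has_weak_deriv_unique_AE:
  assumes "g \<in> L2" and "g' \<in> L2" and "has_weak_deriv v g" and "has_weak_deriv v g'"
  shows "AE x in unit_interval. g x = g' x"
proof -
  have "(\<lambda>x. 1 * g x + (- 1) * g' x) \<in> L2"
    using assms(1,2) by (rule L2_lincomb)
  moreover have "L2_inner (\<lambda>x. 1 * g x + (- 1) * g' x) \<phi> = 0" if "test_function \<phi> \<phi>'" for \<phi> \<phi>'
  proof -
    have "L2_inner (\<lambda>x. 1 * g x + (- 1) * g' x) \<phi> = 1 * L2_inner g \<phi> + (- 1) * L2_inner g' \<phi>"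
      by (rule L2_inner_lincomb) (use assms(1,2) test_function_L2[OF that] in auto)
    then show ?thesis
      using assms(3,4) that unfolding has_weak_deriv_iff by (smt (verit))
  qed
  ultimately have "AE x in unit_interval. 1 * g x + (- 1) * g' x = 0"
    by (rule orthogonal_test_functions_imp_AE_zero)
  then show ?thesis
    by eventually_elim simp
qed

lemma H1_L2: "v \<in> H1 \<Longrightarrow> v \<in> L2"
  by (simp add: H1_def)

lemma weak_deriv_H1:
  assumes "v \<in> H1"
  shows "weak_deriv v \<in> L2" and "has_weak_deriv v (weak_deriv v)"
  using someI_ex[of "\<lambda>g. g \<in> L2 \<and> has_weak_deriv v g"] assms
  by (auto simp: H1_def weak_deriv_def)

lemma L2_scale: "f \<in> L2 \<Longrightarrow> (\<lambda>x. c * f x) \<in> L2"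
  using L2_lincomb[of f f c 0] by simp

lemma has_weak_deriv_scale:
  assumes "has_weak_deriv v g"
  shows "has_weak_deriv (\<lambda>x. c * v x) (\<lambda>x. c * g x)"
  using assms by (simp add: has_weak_deriv_iff L2_inner_def mult.assoc)

lemma H1_scale:
  assumes "v \<in> H1"
  shows "(\<lambda>x. c * v x) \<in> H1"
  using assms L2_scale has_weak_deriv_scale unfolding H1_def by blast

text \<open>The derivative chosen for \<open>c * v\<close> need not equal \<open>c\<close> times the
  one chosen for \<open>v\<close> at every point. They agree almost everywhere by uniqueness, which
  suffices under the integral. This relates the norms of \<open>Yhat n\<close> and
  \<open>Y n\<close>.\<close>

lemma H1_norm_power2_scale:
  assumes "v \<in> H1"
  shows "(H1_norm (\<lambda>x. c * v x))\<^sup>2 = c\<^sup>2 * (H1_norm v)\<^sup>2"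
proof -
  note dv = weak_deriv_H1[OF assms] and dcv = weak_deriv_H1[OF H1_scale[OF assms, of c]]
  have "AE x in unit_interval. weak_deriv (\<lambda>x. c * v x) x = c * weak_deriv v x"
    by (rule has_weak_deriv_unique_AE[OF dcv(1) L2_scale[OF dv(1)] dcv(2) has_weak_deriv_scale[OF dv(2)]])
  then have "L2_inner (weak_deriv (\<lambda>x. c * v x)) (weak_deriv (\<lambda>x. c * v x))
      = L2_inner (\<lambda>x. c * weak_deriv v x) (\<lambda>x. c * weak_deriv v x)"
    unfolding L2_inner_def
    using L2_measurable[OF dv(1)] L2_measurable[OF dcv(1)]
    by (intro integral_cong_AE) (auto elim: eventually_mono)
  then show ?thesis
    using L2_norm_power2_scale[of c "weak_deriv v"] L2_norm_power2_scale[of c v]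
    by (simp add: H1_norm_power2 L2_norm_power2 algebra_simps)
qed

text \<open>Integration by parts: the fundamental theorem of calculus, with the finite exceptional
  set \<open>S\<close>, is applied to the product of \<open>v\<close> and a test function.
  Continuity of \<open>v\<close> rules out jump terms at the points of \<open>S\<close>.\<close>

lemma H1_piecewise_C1:
  assumes "finite S" and v: "continuous_on {0..1} v"
    and deriv: "\<And>x. x \<in> {0<..<1} - S \<Longrightarrow> (v has_real_derivative g x) (at x)"
    and g: "g \<in> L2"
  shows "v \<in> H1"
proof -
  have "L2_inner v \<phi>' = - L2_inner g \<phi>" if \<phi>: "test_function \<phi> \<phi>'" for \<phi> \<phi>'
  proof -
    have int: "integrable unit_interval (\<lambda>x. v x * \<phi>' x)" "integrable unit_interval (\<lambda>x. g x * \<phi> x)"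
      using L2_continuous[OF v] g test_function_L2[OF \<phi>] by (auto intro: L2_mult_integrable)
    have "((\<lambda>x. v x * \<phi>' x + g x * \<phi> x) has_integral (v 1 * \<phi> 1 - v 0 * \<phi> 0)) {0..1}"
    proof (rule fundamental_theorem_of_calculus_interior_strong[OF \<open>finite S\<close>])
      fix x assume "x \<in> {0<..<1} - S"
      then have "(v has_real_derivative g x) (at x)" "(\<phi> has_real_derivative \<phi>' x) (at x)"
        using deriv \<phi> by (auto simp: test_function_def)
      then show "((\<lambda>x. v x * \<phi> x) has_vector_derivative v x * \<phi>' x + g x * \<phi> x) (at x)"
        by (auto intro!: derivative_eq_intros simp: has_real_derivative_iff_has_vector_derivative[symmetric])
    qed (use v test_function_continuous[OF \<phi>] in \<open>auto intro: continuous_intros\<close>)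
    \<comment> \<open>The support lies in the open interval, so both boundary terms vanish.\<close>
    moreover have "\<phi> 0 = 0" "\<phi> 1 = 0"
      using \<phi> by (force simp: test_function_def)+
    ultimately have "((\<lambda>x. v x * \<phi>' x + g x * \<phi> x) has_integral 0) {0<..<1}"
      by (simp add: has_integral_Icc_iff_Ioo)
    \<comment> \<open>The gauge integral from the fundamental theorem is identified with the
      Lebesgue integral.\<close>
    moreover have "((\<lambda>x. v x * \<phi>' x + g x * \<phi> x) has_integral
        (\<integral>x. v x * \<phi>' x + g x * \<phi> x \<partial>unit_interval)) {0<..<1}"
      using int by (intro has_integral_integral_lebesgue_on) auto
    ultimately have "(\<integral>x. v x * \<phi>' x + g x * \<phi> x \<partial>unit_interval) = 0"
      using has_integral_unique by blast
    then show ?thesis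
      using int by (simp add: L2_inner_def)
  qed
  then have "has_weak_deriv v g"
    by (simp add: has_weak_deriv_iff)
  then show ?thesis
    using g L2_continuous[OF v] by (auto simp: H1_def)
qed

section \<open>Partitions and the finite element space\<close>

lemma unit_partition_mono:
  assumes "unit_partition x N" and "i \<le> j" and "j \<le> N"
  shows "x i \<le> x j"
  using assms(2,3)
proof (induction j rule: dec_induct)
  case (step n)
  then have "x n < x (Suc n)"
    using assms(1) by (auto simp: unit_partition_def dest: bspec[of _ _ "Suc n"])
  with step show ?case by simp
qed simp

text \<open>The right end of the cell is the first node beyond \<open>s\<close>. By minimality the
  preceding node is at most \<open>s\<close>, and equality is excluded because \<open>s\<close> is
  not a node.\<close>

lemma unit_partition_cell:
  assumes part: "unit_partition x N" and s: "s \<in> {0<..<1}" and "s \<notin> x ` {..N}"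
  obtains j where "j \<in> {1..N}" "s \<in> {x (j - 1)<..<x j}"
proof -
  define j where "j = (LEAST j. s < x j)"
  have N: "s < x N"
    using part s by (simp add: unit_partition_def)
  then have j: "s < x j" "j \<le> N"
    unfolding j_def by (auto intro: LeastI Least_le)
  have "j \<noteq> 0"
    using part s j(1) by (auto simp: unit_partition_def intro: gr0I)
  then have "\<not> s < x (j - 1)"
    unfolding j_def by (intro not_less_Least) simp
  moreover have "s \<noteq> x (j - 1)"
    using assms(3) j(2) by auto
  ultimately show thesis
    using j \<open>j \<noteq> 0\<close> by (intro that[of j]) auto
qed

lemma unit_partition_cell_unique:
  assumes part: "unit_partition x N" and "i \<in> {1..N}" and "j \<in> {1..N}"
    and "s \<in> {x (i - 1)<..<x i}" and "s \<in> {x (j - 1)<..<x j}"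
  shows "i = j"
proof (rule linorder_cases[of i j])
  assume "i < j"
  then have "x i \<le> x (j - 1)"
    using assms by (intro unit_partition_mono[OF part]) auto
  with assms show ?thesis by auto
next
  assume "j < i"
  then have "x j \<le> x (i - 1)"
    using assms by (intro unit_partition_mono[OF part]) auto
  with assms show ?thesis by auto
qed

text \<open>This places the mesh size in the range for which \<open>interpolation_operators\<close>
  gives its error bound.\<close>

lemma mesh_size_le_1:
  assumes "unit_partition x N"
  shows "mesh_size x N \<le> 1"
proof -
  have "x j - x (j - 1) \<le> 1" if "j \<in> {1..N}" for j
    using unit_partition_mono[OF assms, of 0 "j - 1"] unit_partition_mono[OF assms, of j N] that assms
    by (auto simp: unit_partition_def intro!: diff_mono[of _ 1 0, simplified])
  then show ?thesis
    using assms by (auto simp: mesh_size_def unit_partition_def)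
qed

lemma fe_space_continuous: "v \<in> fe_space x N \<Longrightarrow> continuous_on {0..1} v"
  by (simp add: fe_space_def)

text \<open>The weak derivative is the piecewise derivative of the cell polynomials; the nodes form
  the finite exceptional set of \<open>H1_piecewise_C1\<close>.\<close>

lemma fe_space_subset_H1:
  assumes part: "unit_partition x N"
  shows "fe_space x N \<subseteq> H1"
proof
  fix v assume v: "v \<in> fe_space x N"
  then obtain p :: "nat \<Rightarrow> real poly"
    where p: "\<And>j s. j \<in> {1..N} \<Longrightarrow> s \<in> {x (j - 1)<..<x j} \<Longrightarrow> v s = poly (p j) s"
    unfolding fe_space_def by (auto dest!: bchoice)
  \<comment> \<open>The cells are open and disjoint, so at most one summand is nonzero, and
    \<open>g\<close> has the value 0 at the nodes.\<close>
  define g where "g s = (\<Sum>j\<in>{1..N}. indicator {x (j - 1)<..<x j} s * poly (pderiv (p j)) s)" for s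
  show "v \<in> H1"
  proof (rule H1_piecewise_C1)
    show "finite (x ` {..N})" by simp
    show "continuous_on {0..1} v"
      using v by (rule fe_space_continuous)
    show "(v has_real_derivative g s) (at s)" if s: "s \<in> {0<..<1} - x ` {..N}" for s
    proof -
      obtain j where j: "j \<in> {1..N}" "s \<in> {x (j - 1)<..<x j}"
        using unit_partition_cell[OF part] s by blast
      have "g s = (\<Sum>i\<in>{1..N}. if i = j then poly (pderiv (p j)) s else 0)"
        unfolding g_def
      proof (intro sum.cong refl)
        fix i assume "i \<in> {1..N}"
        then show "indicator {x (i - 1)<..<x i} s * poly (pderiv (p i)) s
            = (if i = j then poly (pderiv (p j)) s else 0)"
          using unit_partition_cell_unique[OF part _ j(1) _ j(2), of i] j(2)
          by (cases "i = j") (auto simp: indicator_def)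
      qed
      then have "g s = poly (pderiv (p j)) s"
        using j(1) by simp
      then have "(poly (p j) has_real_derivative g s) (at s)"
        using poly_DERIV[of "p j" s] by simp
      then show ?thesis
        by (rule has_field_derivative_transform_within_open[of _ _ _ "{x (j - 1)<..<x j}"])
          (use j p[OF j(1)] in auto)
    qed
    have cont: "continuous_on A (poly q)" for A and q :: "real poly"
      by (intro continuous_intros)
    have "\<exists>B. \<forall>s\<in>{0..1}. \<bar>poly q s\<bar> \<le> B" for q :: "real poly"
      using continuous_bounded_unit_interval[OF cont] by metis
    then obtain B where B: "\<And>q s. s \<in> {0..1} \<Longrightarrow> \<bar>poly q s\<bar> \<le> B (q :: real poly)"
      by metis
    show "g \<in> L2"
    proof (rule L2_bounded)
      have "indicat_real {a<..<b} \<in> borel_measurable unit_interval" for a b :: real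
        by (intro measurable_restrict_space1 borel_measurable_indicator) simp
      then show "g \<in> borel_measurable unit_interval"
        unfolding g_def
        by (intro borel_measurable_sum borel_measurable_times)
          (auto intro: borel_measurable_unit_interval_continuous cont)
      show "\<bar>g s\<bar> \<le> (\<Sum>j\<in>{1..N}. B (pderiv (p j)))" if "s \<in> {0<..<1}" for s
        unfolding g_def
        \<comment> \<open>The bounds \<open>B\<close> are nonnegative since they dominate absolute
          values; this handles the cells that do not contain \<open>s\<close>.\<close>
        using that B[of s] abs_ge_zero[THEN order_trans, OF B[of s]]
        by (intro sum_norm_le[where 'a = real, simplified]) (auto simp: indicator_def)
    qed
  qed
qed

section \<open>Discrete energy inequality and stability\<close>

text \<open>One time step tested with its own solution: \<open>v\<close> is the previous value,
  \<open>w\<close> the interpolant of \<open>u\<close>, and \<open>c\<close> stands for the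
  interpolation constant times the mesh size. Writing the squared norm of the derivative as the
  difference of the squared \<open>H1\<close> and \<open>L2\<close> norms, then multiplying by
  \<open>2 * k\<close>, produces the coefficients shown.\<close>

lemma backward_euler_energy:
  fixes k \<nu> \<gamma> \<delta> \<mu> c E :: real
  assumes u: "u \<in> H1" and v: "v \<in> L2" and w: "w \<in> L2"
    and "k > 0" and "\<mu> > 0" and "E > 0"
    and interp: "L2_norm (\<lambda>x. u x - w x) \<le> c * H1_norm u"
    and scheme: "L2_inner (\<lambda>x. (u x - v x) / k) u
        + \<nu> * L2_inner (weak_deriv u) (weak_deriv u) - \<gamma> * L2_inner u u
        + \<delta> * L2_inner (\<lambda>x. (u x) ^ 3) u = - \<mu> * L2_inner w u"
  shows "(2 - E) * (L2_norm u)\<^sup>2 - (L2_norm v)\<^sup>2 / E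
      + k * ((2 * \<nu> - \<mu> * c\<^sup>2) * (H1_norm u)\<^sup>2 + (\<mu> - 2 * \<nu> - 2 * \<gamma>) * (L2_norm u)\<^sup>2
        + 2 * \<delta> * (L4_norm u) ^ 4) \<le> 0"
proof -
  note u2 = H1_L2[OF u]
  have diff: "L2_inner (\<lambda>x. (u x - v x) / k) u = ((L2_norm u)\<^sup>2 - L2_inner v u) / k"
    using L2_inner_lincomb[OF u2 v u2, of "1 / k" "- (1 / k)"]
    by (simp add: L2_norm_power2 diff_divide_distrib)
  \<comment> \<open>The weight \<open>1 / E\<close> damps the old value and charges \<open>E\<close>
    to the new one.\<close>
  have Young_time: "L2_inner v u \<le> ((L2_norm v)\<^sup>2 / E + E * (L2_norm u)\<^sup>2) / 2"
    using L2_inner_Young[OF v u2, of "1 / E"] \<open>E > 0\<close> by (simp add: mult.commute)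
  have err: "(\<lambda>x. u x - w x) \<in> L2"
    using L2_lincomb[OF u2 w, of 1 "- 1"] by simp
  \<comment> \<open>The interpolant is split as \<open>u\<close> minus its error. Half of the
    squared \<open>L2\<close> norm of \<open>u\<close> survives Young's inequality, at the cost of
    an \<open>H1\<close> term to be absorbed by diffusion.\<close>
  have "L2_inner w u = (L2_norm u)\<^sup>2 - L2_inner (\<lambda>x. u x - w x) u"
    using L2_inner_lincomb[OF u2 w u2, of 1 "- 1"] by (simp add: L2_norm_power2)
  moreover have "L2_inner (\<lambda>x. u x - w x) u \<le> ((L2_norm (\<lambda>x. u x - w x))\<^sup>2 + (L2_norm u)\<^sup>2) / 2"
    using L2_inner_Young[OF err u2, of 1] by simp
  moreover have "(L2_norm (\<lambda>x. u x - w x))\<^sup>2 \<le> c\<^sup>2 * (H1_norm u)\<^sup>2"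
  proof -
    have "0 \<le> L2_norm (\<lambda>x. u x - w x)"
      by (simp add: L2_norm_def L2_inner_def)
    then show ?thesis
      using power_mono[OF interp, of 2] by (simp add: power_mult_distrib)
  qed
  ultimately have "L2_inner w u \<ge> (L2_norm u)\<^sup>2 / 2 - c\<^sup>2 * (H1_norm u)\<^sup>2 / 2"
    by (simp add: field_simps)
  then have nudge: "- \<mu> * L2_inner w u \<le> - \<mu> * ((L2_norm u)\<^sup>2 / 2 - c\<^sup>2 * (H1_norm u)\<^sup>2 / 2)"
    using \<open>\<mu> > 0\<close> by simp
  have "((L2_norm u)\<^sup>2 - ((L2_norm v)\<^sup>2 / E + E * (L2_norm u)\<^sup>2) / 2) / k
      \<le> ((L2_norm u)\<^sup>2 - L2_inner v u) / k"
    using Young_time \<open>k > 0\<close> by (intro divide_right_mono) auto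
  also have "\<dots> \<le> - \<mu> * ((L2_norm u)\<^sup>2 / 2 - c\<^sup>2 * (H1_norm u)\<^sup>2 / 2)
      - \<nu> * ((H1_norm u)\<^sup>2 - (L2_norm u)\<^sup>2) + \<gamma> * (L2_norm u)\<^sup>2 - \<delta> * (L4_norm u) ^ 4"
    using nudge scheme
    by (simp add: diff L2_inner_cube H1_norm_power2 flip: L2_norm_power2)
  finally show ?thesis
    using \<open>k > 0\<close> by (simp add: field_simps)
qed

theorem lemma4p1:
  fixes \<nu> \<gamma> \<delta> \<mu> h c\<^sub>p \<alpha> \<beta> \<beta>\<^sub>3 \<beta>\<^sub>4 k\<^sub>0 k T :: real
    and x t :: "nat \<Rightarrow> real" and N M :: nat
    and I :: "real \<Rightarrow> (real \<Rightarrow> real) \<Rightarrow> (real \<Rightarrow> real)"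
    and y\<^sub>0 :: "real \<Rightarrow> real" and Y Yhat :: "nat \<Rightarrow> real \<Rightarrow> real"
  assumes "interpolation_operators I c\<^sub>p"
    and "unit_partition x N" and "h = mesh_size x N"
    and "\<nu> > 0" and "\<gamma> > 0" and "\<delta> > 0" and "\<mu> > 0" and "h > 0"
    and "\<nu> \<ge> \<mu> * c\<^sub>p\<^sup>2 * h\<^sup>2 / 2" and "\<mu> \<ge> 2 * (\<gamma> + \<nu>)"
    and "\<beta> = 2 * \<nu> - \<mu> * c\<^sub>p\<^sup>2 * h\<^sup>2" and "\<beta> > 0"
    and "\<beta>\<^sub>3 = \<mu> - 2 * \<nu> - 2 * \<gamma>" and "\<beta>\<^sub>3 \<ge> 0"
    and "0 < \<alpha>" and "\<alpha> \<le> (\<mu> - 2 * \<gamma> - 2 * \<nu>) / 2"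
    and "k\<^sub>0 > 0"
    and "\<And>\<kappa>. 0 < \<kappa> \<Longrightarrow> \<kappa> \<le> k\<^sub>0 \<Longrightarrow> exp (\<alpha> * \<kappa>) < 1 + \<kappa> * \<beta>\<^sub>3 / 2"
    and "T > 0" and "M \<ge> 1" and "k = T / real M" and "0 < k" and "k \<le> k\<^sub>0"
    and "\<And>n. t n = real n * k"
    and "y\<^sub>0 \<in> fe_space x N"
    and "backward_euler_solution (fe_space x N) (I h) \<nu> \<gamma> \<delta> \<mu> k M y\<^sub>0 Y"
    and "\<And>n. Yhat n = (\<lambda>s. exp (\<alpha> * t n) * Y n s)"
    and "\<beta>\<^sub>4 = min (\<beta> * exp (- \<alpha> * k)) (\<beta>\<^sub>3 * exp (- \<alpha> * k) - 2 * (1 - exp (- \<alpha> * k)) / k)"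
  shows "\<beta>\<^sub>4 > 0 \<and>
    (L2_norm (Y M))\<^sup>2
    + k * \<beta>\<^sub>4 * exp (- \<alpha> * (k + 2 * t M)) * (\<Sum>n=1..M. (H1_norm (Yhat n))\<^sup>2)
    + 2 * k * \<delta> * exp (- 2 * \<alpha> * t M)
        * (\<Sum>n=1..M. exp (- \<alpha> * (2 * t n + k)) * (L4_norm (Yhat n)) ^ 4)
    \<le> exp (- 2 * \<alpha> * t M) * (L2_norm (Y 0))\<^sup>2"
proof -
  note part = assms(2) and euler = assms(26)
  define E where "E = exp (\<alpha> * k)"
  have E: "E > 1"
    using \<open>0 < \<alpha>\<close> \<open>0 < k\<close> by (simp add: E_def)
  have E_inv: "exp (- \<alpha> * k) = 1 / E"
    by (simp add: E_def exp_minus inverse_eq_divide)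
  have "E < 1 + k * \<beta>\<^sub>3 / 2"
    unfolding E_def using \<open>0 < k\<close> \<open>k \<le> k\<^sub>0\<close> by (rule assms(18))
  \<comment> \<open>After multiplication by \<open>k * E / 2\<close> this is exactly the step size
    condition.\<close>
  then have b3: "\<beta>\<^sub>3 / E - 2 * (1 - 1 / E) / k > 0"
    using E \<open>0 < k\<close> by (simp add: field_simps)
  have b4: "\<beta>\<^sub>4 = min (\<beta> / E) (\<beta>\<^sub>3 / E - 2 * (1 - 1 / E) / k)"
    unfolding assms(28) E_inv by simp
  then have "\<beta>\<^sub>4 > 0"
    using b3 \<open>\<beta> > 0\<close> E by simp

  have Y: "Y n \<in> fe_space x N" if "n \<le> M" for n
    using that euler \<open>y\<^sub>0 \<in> fe_space x N\<close>
    by (cases "n = 0") (auto simp: backward_euler_solution_def)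
  then have YH1: "Y n \<in> H1" if "n \<le> M" for n
    using that fe_space_subset_H1[OF part] by blast
  have h: "0 < h" "h \<le> 1"
    using assms(3,8) mesh_size_le_1[OF part] by auto

  \<comment> \<open>Here \<open>a n\<close> and \<open>b n\<close> are the squared norms of
    \<open>Yhat n\<close>. In \<open>q n\<close> the fourth power of \<open>Yhat n\<close> would
    give \<open>exp (4 * \<alpha> * t n)\<close>; the weight in the theorem reduces this to
    \<open>exp (2 * \<alpha> * t n) / E\<close>.\<close>
  define a where "a n = exp (2 * \<alpha> * t n) * (L2_norm (Y n))\<^sup>2" for n
  define b where "b n = exp (2 * \<alpha> * t n) * (H1_norm (Y n))\<^sup>2" for n
  define q where "q n = exp (2 * \<alpha> * t n) * (L4_norm (Y n)) ^ 4 / E" for n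
  have step: "a (Suc n) + k * \<beta>\<^sub>4 * b (Suc n) + 2 * k * \<delta> * q (Suc n) \<le> a n" if n: "Suc n \<le> M" for n
  proof -
    let ?u = "Y (Suc n)" and ?s = "exp (2 * \<alpha> * t (Suc n))"
    have u: "?u \<in> H1"
      using YH1 n by blast
    have "(2 - E) * (L2_norm ?u)\<^sup>2 - (L2_norm (Y n))\<^sup>2 / E
      + k * ((2 * \<nu> - \<mu> * (c\<^sub>p * h)\<^sup>2) * (H1_norm ?u)\<^sup>2 + (\<mu> - 2 * \<nu> - 2 * \<gamma>) * (L2_norm ?u)\<^sup>2
        + 2 * \<delta> * (L4_norm ?u) ^ 4) \<le> 0"
    proof (rule backward_euler_energy[OF u])
      show "Y n \<in> L2"
        using H1_L2 YH1 n by simp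
      show "I h ?u \<in> L2" "L2_norm (\<lambda>s. ?u s - I h ?u s) \<le> c\<^sub>p * h * H1_norm ?u"
        using assms(1) h u by (auto simp: interpolation_operators_def)
      show "L2_inner (\<lambda>s. (?u s - Y n s) / k) ?u
          + \<nu> * L2_inner (weak_deriv ?u) (weak_deriv ?u) - \<gamma> * L2_inner ?u ?u
          + \<delta> * L2_inner (\<lambda>s. (?u s) ^ 3) ?u = - \<mu> * L2_inner (I h ?u) ?u"
        using euler n unfolding backward_euler_solution_def by force
    qed (use \<open>0 < k\<close> \<open>\<mu> > 0\<close> E in auto)
    \<comment> \<open>The multiplier turns the coefficient of the old squared norm into
      \<open>?s / E\<^sup>2\<close>, which is \<open>exp (2 * \<alpha> * t n)\<close>, so the term
      becomes \<open>a n\<close> and the estimate telescopes.\<close>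
    then have energy: "?s / E * ((2 - E) * (L2_norm ?u)\<^sup>2 - (L2_norm (Y n))\<^sup>2 / E
      + k * (\<beta> * (H1_norm ?u)\<^sup>2 + \<beta>\<^sub>3 * (L2_norm ?u)\<^sup>2 + 2 * \<delta> * (L4_norm ?u) ^ 4)) \<le> 0"
      using E assms(11,13) by (intro mult_nonneg_nonpos) (auto simp: power_mult_distrib mult.assoc)
    have s: "?s = E\<^sup>2 * exp (2 * \<alpha> * t n)"
      by (simp add: assms(24) E_def field_simps flip: exp_add exp_of_nat_mult)
    \<comment> \<open>Since \<open>(2 - E) / E = 1 - 2 * (1 - 1 / E)\<close>, the new squared norm
      gives a full \<open>a (Suc n)\<close>, and the deficit is charged to the
      \<open>\<beta>\<^sub>3\<close> term.\<close>
    have "S * A + k * (\<beta> / E) * (S * B) + k * (\<beta>\<^sub>3 / E - 2 * (1 - 1 / E) / k) * (S * A)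
        + 2 * k * \<delta> * (S * Q / E) - r * V
        = S / E * ((2 - E) * A - V / E + k * (\<beta> * B + \<beta>\<^sub>3 * A + 2 * \<delta> * Q))"
      if "S = E\<^sup>2 * r" for S r A B Q V
      unfolding that using E \<open>0 < k\<close> by (simp add: field_simps power2_eq_square)
    from this[OF s] energy have "a (Suc n) + k * (\<beta> / E) * b (Suc n)
        + k * (\<beta>\<^sub>3 / E - 2 * (1 - 1 / E) / k) * a (Suc n) + 2 * k * \<delta> * q (Suc n) - a n \<le> 0"
      unfolding a_def b_def q_def by (simp only:)
    moreover have "k * \<beta>\<^sub>4 * b (Suc n) \<le> k * (\<beta> / E) * b (Suc n)"
      using b4 \<open>0 < k\<close> by (intro mult_right_mono mult_left_mono) (auto simp: b_def)
    moreover have "0 \<le> k * (\<beta>\<^sub>3 / E - 2 * (1 - 1 / E) / k) * a (Suc n)"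
      using b3 \<open>0 < k\<close> by (intro mult_nonneg_nonneg) (auto simp: a_def)
    ultimately show ?thesis
      by linarith
  qed
  have sum: "a m + k * \<beta>\<^sub>4 * (\<Sum>n=1..m. b n) + 2 * k * \<delta> * (\<Sum>n=1..m. q n) \<le> a 0" if "m \<le> M" for m
    using that
  proof (induction m)
    case (Suc m)
    then show ?case
      using step[of m] by (simp add: distrib_left)
  qed simp

  have b_hat: "(H1_norm (Yhat n))\<^sup>2 = b n" if "n \<in> {1..M}" for n
  proof -
    have "(H1_norm (Yhat n))\<^sup>2 = (exp (\<alpha> * t n))\<^sup>2 * (H1_norm (Y n))\<^sup>2"
      unfolding assms(27) by (rule H1_norm_power2_scale) (use YH1 that in simp)
    then show ?thesis
      by (simp add: b_def mult.assoc flip: exp_double)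
  qed
  have q_hat: "exp (- \<alpha> * (2 * t n + k)) * (L4_norm (Yhat n)) ^ 4 = q n" for n
  proof -
    have "exp (- \<alpha> * (2 * t n + k)) * exp (\<alpha> * t n) ^ 4 = exp (2 * \<alpha> * t n) / E"
      unfolding E_def by (simp add: algebra_simps flip: exp_of_nat_mult exp_add exp_diff)
    then show ?thesis
      unfolding assms(27) L4_norm_power4_scale q_def by (simp flip: mult.assoc)
  qed
  \<comment> \<open>Multiplication by \<open>D\<close> removes the weight from
    \<open>a M\<close>.\<close>
  define D where "D = exp (- 2 * \<alpha> * t M)"
  have D: "D > 0"
    by (simp add: D_def)
  have "D * exp (2 * \<alpha> * t M) = 1"
    by (simp add: D_def flip: exp_add)
  then have D_a: "D * a M = (L2_norm (Y M))\<^sup>2"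
    by (simp add: a_def flip: mult.assoc)
  \<comment> \<open>The claimed factor of the \<open>H1\<close> sum is \<open>D / E\<close>, so this
    nonnegative sum is first reduced by the factor \<open>1 / E\<close>, which is below 1.\<close>
  have "0 \<le> k * \<beta>\<^sub>4 * (\<Sum>n=1..M. b n)"
    using \<open>0 < k\<close> \<open>\<beta>\<^sub>4 > 0\<close> by (auto simp: b_def intro!: mult_nonneg_nonneg sum_nonneg)
  then have "k * \<beta>\<^sub>4 * (\<Sum>n=1..M. b n) / E \<le> k * \<beta>\<^sub>4 * (\<Sum>n=1..M. b n) / 1"
    using E by (intro divide_left_mono) auto
  with sum[of M] have "a M + k * \<beta>\<^sub>4 * (\<Sum>n=1..M. b n) / E + 2 * k * \<delta> * (\<Sum>n=1..M. q n) \<le> a 0"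
    by simp
  then have "D * (a M + k * \<beta>\<^sub>4 * (\<Sum>n=1..M. b n) / E + 2 * k * \<delta> * (\<Sum>n=1..M. q n)) \<le> D * a 0"
    using D by simp
  then have "D * a M + k * \<beta>\<^sub>4 * (D / E) * (\<Sum>n=1..M. b n) + 2 * k * \<delta> * D * (\<Sum>n=1..M. q n) \<le> D * a 0"
    by (simp add: algebra_simps)
  moreover have "exp (- \<alpha> * (k + 2 * t M)) = D / E"
    by (simp add: D_def E_def algebra_simps flip: exp_diff)
  moreover have "a 0 = (L2_norm (Y 0))\<^sup>2"
    by (simp add: a_def assms(24))
  moreover have "(\<Sum>n=1..M. (H1_norm (Yhat n))\<^sup>2) = (\<Sum>n=1..M. b n)"
    by (intro sum.cong refl b_hat)
  ultimately show ?thesis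
    using \<open>\<beta>\<^sub>4 > 0\<close> by (simp only: q_hat D_a D_def[symmetric] simp_thms)
qed

end
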